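(* Let $G$ be a distance-regular graph of diameter $3$. Then $G$ exhibits perfect state transfer (for the Grover walk) if and only if $G$ is isomorphic to the cycle $C_6$.
   Context: A connected graph $G$ is distance-regular if for any vertices $u,v$ the number of vertices at distance $i$ from $u$ and distance $j$ from $v$ depends only on $i,j$ and $\operatorname{dist}(u,v)$. Grover walk: for a finite simple graph $G$ without isolated vertices, arcs $\mathcal{A}(G)=\{(u,v),(v,u):uv\in E(G)\}$, $t((u,v))=v$, $(u,v)^{-1}=(v,u)$; shift $S_{ab}=\delta_{a,b^{-1}}$; boundary $N_{ua}=\frac{1}{\sqrt{\deg u}}\delta_{u,t(a)}$; $U=S(2N^*N-I)$; $\Phi_u=N^*\mathbf{e}_u$. $G$ exhibits perfect state transfer if there exist vertices $u\ne v$, a positive integer $\tau$ and a unimodular $\gamma\in\mathbb{C}$ with $U^\tau\Phi_u=\gamma\Phi_v$. *)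

theory Defs
  imports Complex_Main "Graph_Theory.Graph_Theory"
begin

text \<open>
  Finite simple graphs are rendered by the locale \<^locale>\<open>pair_graph\<close>: a finite vertex set together
  with a finite symmetric irreflexive set of ordered pairs.  The set \<^term>\<open>parcs G\<close> contains both
  orientations of every edge, hence it is the arc set of the Grover walk; an arc \<open>a\<close> has origin
  \<^term>\<open>fst a\<close>, terminus \<^term>\<open>snd a\<close> and inverse \<^term>\<open>prod.swap a\<close>.
\<close>

section \<open>Distance-regular graphs\<close>

text \<open>Length of a shortest walk; only meaningful if \<open>v\<close> is reachable from \<open>u\<close>.\<close>

definition graph_dist :: "'a pair_pre_digraph \<Rightarrow> 'a \<Rightarrow> 'a \<Rightarrow> nat" where
  "graph_dist G u v = (LEAST n. \<exists>p. pre_digraph.awalk (with_proj G) u p v \<and> length p = n)"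

lemma ereal_graph_dist_eq_mu:
  assumes "pair_wf_digraph G" and "u \<rightarrow>\<^sup>*\<^bsub>with_proj G\<^esub> v"
  shows "ereal (real (graph_dist G u v)) = wf_digraph.\<mu> (with_proj G) (\<lambda>_. 1) u v"
proof -
  interpret pair_wf_digraph G by fact
  have cost: "awalk_cost (\<lambda>_. 1) p = real (length p)" for p
    by (induction p) auto
  from assms(2) obtain q where q: "awalk u q v"
    by (auto simp: reachable_awalk)
  have "\<exists>p. awalk u p v \<and> length p = graph_dist G u v"
    unfolding graph_dist_def by (rule LeastI) (use q in blast)
  then obtain p where p: "awalk u p v" "length p = graph_dist G u v" by blast
  have le: "graph_dist G u v \<le> length r" if "awalk u r v" for r
    unfolding graph_dist_def by (rule Least_le) (use that in blast)
  have "\<mu> (\<lambda>_. 1) u v = ereal (real (graph_dist G u v))"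
    unfolding \<mu>_def
    by (rule INF_eqI) (use le p cost in \<open>force+\<close>)
  then show ?thesis by simp
qed

definition graph_diameter :: "'a pair_pre_digraph \<Rightarrow> nat" where
  "graph_diameter G = Max {graph_dist G u v | u v. u \<in> pverts G \<and> v \<in> pverts G}"

definition distance_regular :: "'a pair_pre_digraph \<Rightarrow> bool" where
  "distance_regular G \<longleftrightarrow> connected (with_proj G) \<and>
    (\<exists>c :: nat \<Rightarrow> nat \<Rightarrow> nat \<Rightarrow> nat. \<forall>u \<in> pverts G. \<forall>v \<in> pverts G. \<forall>i j.
      card {w \<in> pverts G. graph_dist G u w = i \<and> graph_dist G v w = j}
        = c i j (graph_dist G u v))"

text \<open>The cycle on \<open>n\<close> vertices, for \<open>n \<ge> 3\<close>.\<close>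

definition cycle_graph :: "nat \<Rightarrow> nat pair_pre_digraph" where
  "cycle_graph n = \<lparr>pverts = {..<n},
     parcs = {(i, j). i < n \<and> j < n \<and> (j = (i + 1) mod n \<or> i = (j + 1) mod n)}\<rparr>"


section \<open>Matrices indexed by finite sets\<close>

text \<open>
  A complex matrix is a function of its two indices.  The finite set over which a product sums is
  an explicit argument; only the entries whose indices lie in the intended index sets matter.
\<close>

type_synonym ('i, 'j) fmat = "'i \<Rightarrow> 'j \<Rightarrow> complex"

definition fmat_mult :: "'k set \<Rightarrow> ('i, 'k) fmat \<Rightarrow> ('k, 'j) fmat \<Rightarrow> ('i, 'j) fmat" where
  "fmat_mult K A B = (\<lambda>i j. \<Sum>k\<in>K. A i k * B k j)"

definition fmat_vec :: "'k set \<Rightarrow> ('i, 'k) fmat \<Rightarrow> ('k \<Rightarrow> complex) \<Rightarrow> 'i \<Rightarrow> complex" where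
  "fmat_vec K A x = (\<lambda>i. \<Sum>k\<in>K. A i k * x k)"

definition fmat_one :: "('i, 'i) fmat" where
  "fmat_one = (\<lambda>i j. if i = j then 1 else 0)"

definition fmat_adjoint :: "('i, 'j) fmat \<Rightarrow> ('j, 'i) fmat" where
  "fmat_adjoint A = (\<lambda>j i. cnj (A i j))"

primrec fmat_power :: "'i set \<Rightarrow> ('i, 'i) fmat \<Rightarrow> nat \<Rightarrow> ('i, 'i) fmat" where
  "fmat_power K A 0 = fmat_one"
| "fmat_power K A (Suc n) = fmat_mult K A (fmat_power K A n)"

definition unit_fvec :: "'i \<Rightarrow> 'i \<Rightarrow> complex" where
  "unit_fvec u = (\<lambda>x. if x = u then 1 else 0)"


section \<open>Grover walk\<close>

definition grover_shift :: "('a \<times> 'a, 'a \<times> 'a) fmat" where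
  "grover_shift = (\<lambda>a b. if a = prod.swap b then 1 else 0)"

definition grover_boundary :: "'a pair_pre_digraph \<Rightarrow> ('a, 'a \<times> 'a) fmat" where
  "grover_boundary G = (\<lambda>u a.
     1 / complex_of_real (sqrt (real (out_degree (with_proj G) u))) * (if u = snd a then 1 else 0))"

definition grover_matrix :: "'a pair_pre_digraph \<Rightarrow> ('a \<times> 'a, 'a \<times> 'a) fmat" where
  "grover_matrix G = fmat_mult (parcs G) grover_shift
     (\<lambda>a b. 2 * fmat_mult (pverts G) (fmat_adjoint (grover_boundary G)) (grover_boundary G) a b
              - fmat_one a b)"

definition grover_vertex_state :: "'a pair_pre_digraph \<Rightarrow> 'a \<Rightarrow> 'a \<times> 'a \<Rightarrow> complex" where
  "grover_vertex_state G u = fmat_vec (pverts G) (fmat_adjoint (grover_boundary G)) (unit_fvec u)"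

definition grover_perfect_state_transfer :: "'a pair_pre_digraph \<Rightarrow> bool" where
  "grover_perfect_state_transfer G \<longleftrightarrow>
    (\<exists>u \<in> pverts G. \<exists>v \<in> pverts G. u \<noteq> v \<and>
      (\<exists>\<tau>::nat. \<tau> > 0 \<and> (\<exists>\<gamma>::complex. cmod \<gamma> = 1 \<and>
        (\<forall>a \<in> parcs G.
          fmat_vec (parcs G) (fmat_power (parcs G) (grover_matrix G) \<tau>) (grover_vertex_state G u) a
            = \<gamma> * grover_vertex_state G v a))))"

end

theory Submission
  imports Defs
begin

text \<open>
  Applying the boundary matrix \<open>N\<close> to the iterates of the walk gives \<open>N U\<^sup>\<tau> N\<^sup>* = T\<^sub>\<tau>(A/k)\<close> with the
  Chebyshev polynomial \<open>T\<^sub>\<tau>\<close>, so perfect state transfer from \<open>u\<close> to \<open>v\<close> yields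
  \<open>T\<^sub>\<tau>(A/k) e\<^sub>u = \<gamma> e\<^sub>v\<close>.  The entries of the left-hand side depend only on the distance to \<open>u\<close>, hence
  \<open>v\<close> is the only vertex at its distance from \<open>u\<close>; in diameter 3 this forces that distance to be 3,
  and \<open>G\<close> is an antipodal double cover of a complete graph.  Such a graph has the eigenvalue \<open>-1\<close>, with
  an eigenvector that is 1 at both \<open>u\<close> and \<open>v\<close>, so \<open>\<bar>T\<^sub>\<tau>(-1/k)\<bar> = 1\<close>.  Clearing denominators in the
  Chebyshev recursion, a congruence argument (a case of Niven's theorem) leaves only \<open>k = 2\<close>.
\<close>

section \<open>Unimodular Chebyshev values at \<open>-1/k\<close>\<close>

text \<open>The integer \<open>k\<^sup>n T\<^sub>n(-1/k)\<close>.\<close>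

fun cheb_int :: "int \<Rightarrow> nat \<Rightarrow> int" where
  "cheb_int k 0 = 1"
| "cheb_int k (Suc 0) = - 1"
| "cheb_int k (Suc (Suc n)) = - 2 * cheb_int k (Suc n) - k\<^sup>2 * cheb_int k n"

text \<open>Modulo \<open>k\<close> the recursion loses its last term and only multiplies by
  \<open>-2\<close>. For odd \<open>k\<close> this makes every value with positive index coprime to
  \<open>k\<close>.\<close>

lemma dvd_cheb_int: "k dvd cheb_int k (Suc n) + (- 2) ^ n"
proof (induction n)
  case (Suc n)
  have "cheb_int k (Suc (Suc n)) + (- 2) ^ Suc n
    = - 2 * (cheb_int k (Suc n) + (- 2) ^ n) - k * (k * cheb_int k n)"
    by (simp add: power2_eq_square algebra_simps)
  with Suc show ?case by (metis dvd_diff dvd_mult dvd_triv_left)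
qed simp

text \<open>With \<open>k = 2 * m\<close> the coefficient \<open>k\<^sup>2\<close> is
  \<open>4 * m\<^sup>2\<close>, so each step of the recursion releases one more factor
  \<open>-2\<close>, and the cofactor stays congruent to \<open>-1\<close> modulo
  \<open>m\<close>.\<close>

lemma cheb_int_even:
  "\<exists>q. cheb_int (2 * m) (Suc n) = (- 2) ^ n * (m * q - 1)"
proof (induction n rule: induct_nat_012)
  case 0
  show ?case by (auto intro: exI[of _ 0])
next
  case 1
  show ?case by (auto intro!: exI[of _ "2 * m"] simp: power2_eq_square)
next
  case (ge2 n)
  then obtain p q where pq: "cheb_int (2 * m) (Suc n) = (- 2) ^ n * (m * p - 1)"
    "cheb_int (2 * m) (Suc (Suc n)) = (- 2) ^ Suc n * (m * q - 1)"
    by blast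
  have "cheb_int (2 * m) (Suc (Suc (Suc n)))
    = (- 2) ^ Suc (Suc n) * (m * (q - m * (m * p - 1)) - 1)"
    unfolding cheb_int.simps(3)[of _ "Suc n"] pq by (simp add: power2_eq_square algebra_simps)
  then show ?case by blast
qed

text \<open>The equation makes the value divisible by \<open>k\<close>. If \<open>k\<close> is odd,
  then \<open>k\<close> divides a power of 2 and is 1. If \<open>k = 2 * m\<close>, cancelling
  \<open>2 ^ n\<close> leaves \<open>m\<close> dividing \<open>m * q - 1\<close>, so
  \<open>m\<close> is 1.\<close>

lemma cheb_int_abs_eq_power:
  assumes k: "k > 0" and R: "\<bar>cheb_int (int k) (Suc n)\<bar> = int k ^ Suc n"
  shows "k \<le> 2"
proof (cases "even k")
  case False
  have "int k dvd cheb_int (int k) (Suc n)"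
    using R by (metis dvd_abs_iff dvd_power zero_less_Suc)
  then have "int k dvd (- 2) ^ n"
    using dvd_cheb_int[of "int k" n] by (simp add: dvd_add_right_iff)
  moreover have "coprime (int k) ((- 2) ^ n)"
    using False by simp
  ultimately have "is_unit (int k)"
    by (metis coprime_absorb_left)
  then show ?thesis by simp
next
  case True
  then obtain m where m: "k = 2 * m" by blast
  obtain q where q: "cheb_int (2 * int m) (Suc n) = (- 2) ^ n * (int m * q - 1)"
    using cheb_int_even by blast
  have "2 ^ n * \<bar>int m * q - 1\<bar> = 2 ^ n * (2 * int m ^ Suc n)"
    using R unfolding m by (simp add: q abs_mult power_abs power_mult_distrib)
  then have "\<bar>int m * q - 1\<bar> = 2 * int m ^ Suc n"
    by simp
  then have "int m dvd int m * q - 1"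
    by (metis dvd_abs_iff dvd_mult dvd_power zero_less_Suc)
  then have "int m dvd 1"
    by (metis dvd_diff_right_iff dvd_triv_left)
  then show ?thesis using m by simp
qed

text \<open>The recurrence identifies \<open>r n\<close> as the Chebyshev value at
  \<open>-1/k\<close>, so \<open>k ^ n * r n\<close> is the integer \<open>cheb_int k n\<close>;
  modulus 1 at \<open>\<tau>\<close> means that this integer has absolute value
  \<open>k ^ \<tau>\<close>.\<close>

lemma cheb_recurrence_unimodular:
  fixes r :: "nat \<Rightarrow> complex"
  assumes k: "k > 0" and "r 0 = 1" and "r (Suc 0) = - 1 / of_nat k"
    and "\<And>n. r (Suc (Suc n)) = - 2 / of_nat k * r (Suc n) - r n"
    and "\<tau> > 0" and "cmod (r \<tau>) = 1"
  shows "k \<le> 2"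
proof -
  have R: "of_int (cheb_int (int k) n) = of_nat k ^ n * r n" for n
  proof (induction n rule: induct_nat_012)
    case (ge2 n)
    have "of_nat k ^ Suc (Suc n) * r (Suc (Suc n)) = of_nat k ^ Suc n * (of_nat k * r (Suc (Suc n)))"
      by simp
    also have "of_nat k * r (Suc (Suc n)) = - 2 * r (Suc n) - of_nat k * r n"
      using k by (simp add: assms(4)[of n] field_simps)
    finally show ?case
      by (simp add: ge2 power2_eq_square algebra_simps)
  qed (use assms in auto)
  obtain n where n: "\<tau> = Suc n" using assms(5) gr0_conv_Suc by auto
  have "real_of_int \<bar>cheb_int (int k) (Suc n)\<bar> = cmod (of_int (cheb_int (int k) (Suc n)))"
    by simp
  also have "\<dots> = real k ^ Suc n"
    unfolding R using assms(6) n by (simp add: norm_mult norm_power)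
  finally have "\<bar>cheb_int (int k) (Suc n)\<bar> = int k ^ Suc n"
    by (metis of_int_eq_iff of_int_of_nat_eq of_int_power)
  then show ?thesis using k cheb_int_abs_eq_power by blast
qed

section \<open>The Grover walk\<close>

context pair_graph
begin

section \<open>Neighbourhoods in a finite simple graph\<close>

abbreviation d :: "'a \<Rightarrow> 'a \<Rightarrow> nat" where
  "d \<equiv> graph_dist G"

definition nb :: "'a \<Rightarrow> 'a set" where
  "nb x = {y. (x, y) \<in> parcs G}"

lemma nb_iff: "y \<in> nb x \<longleftrightarrow> (x, y) \<in> parcs G"
  by (simp add: nb_def)

lemma nb_commute: "y \<in> nb x \<longleftrightarrow> x \<in> nb y"
  by (auto simp: nb_iff intro: arcs_symmetric)

lemma nb_subset: "nb x \<subseteq> pverts G"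
  by (auto simp: nb_iff dest: in_arcsD2)

lemma nb_in_verts: "y \<in> nb x \<Longrightarrow> x \<in> pverts G" "y \<in> nb x \<Longrightarrow> y \<in> pverts G"
  by (auto simp: nb_iff dest: in_arcsD1 in_arcsD2)

lemma finite_nb [simp]: "finite (nb x)"
  using nb_subset pair_finite_verts by (rule finite_subset)

lemma not_in_own_nb [simp]: "x \<notin> nb x"
  using pair_no_loops by (force simp: nb_iff)

lemma sum_ends_at:
  fixes f :: "'a \<times> 'a \<Rightarrow> 'b::comm_monoid_add"
  shows "(\<Sum>a | a \<in> parcs G \<and> snd a = x. f a) = (\<Sum>z\<in>nb x. f (z, x))"
  by (rule sum.reindex_bij_witness[where i = "\<lambda>z. (z, x)" and j = fst])
    (auto simp: nb_iff intro: arcs_symmetric)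

lemma out_degree_eq_card_nb: "out_degree (with_proj G) x = card (nb x)"
proof -
  have "out_arcs (with_proj G) x = Pair x ` nb x"
    by (auto simp: out_arcs_def nb_iff)
  then show ?thesis
    by (simp add: out_degree_def card_image inj_on_def)
qed

text \<open>The action of the Grover matrix with all matrix sums carried out. The shift reverses the
  arc, which is why the coin acts at the origin \<open>x\<close> and not at the terminus.\<close>

definition step :: "('a \<times> 'a \<Rightarrow> complex) \<Rightarrow> 'a \<times> 'a \<Rightarrow> complex" where
  "step \<psi> = (\<lambda>(x, y). 2 / of_nat (card (nb x)) * (\<Sum>z\<in>nb x. \<psi> (z, x)) - \<psi> (y, x))"

definition inflow :: "('a \<times> 'a \<Rightarrow> complex) \<Rightarrow> 'a \<Rightarrow> complex" where
  "inflow \<psi> x = (\<Sum>z\<in>nb x. \<psi> (z, x))"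

text \<open>The entry of \<open>N* N\<close> at two arcs is the reciprocal degree of their common
  terminus, or 0 if the termini differ; the shift replaces the row of \<open>a\<close> by that of
  its reversal.\<close>

lemma grover_matrix_vec:
  assumes a: "a \<in> parcs G"
  shows "fmat_vec (parcs G) (grover_matrix G) \<psi> a = step \<psi> a"
proof -
  obtain x y where xy: "a = (x, y)" by (cases a)
  have yx: "(y, x) \<in> parcs G" using a xy arcs_symmetric by simp
  let ?N = "grover_boundary G"
  let ?M = "\<lambda>a b. 2 * fmat_mult (pverts G) (fmat_adjoint ?N) ?N a b - fmat_one a b"
  have deg: "card (nb x) > 0"
    using a xy by (auto simp: card_gt_0_iff nb_iff)
  have M: "?M c b = (if snd c = snd b then 2 / of_nat (card (nb (snd c))) else 0) - fmat_one c b"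
    if "c \<in> parcs G" for c b
  proof -
    have "snd c \<in> pverts G" using that by (rule arc_snd_in_verts)
    have "fmat_mult (pverts G) (fmat_adjoint ?N) ?N c b
      = (\<Sum>w\<in>pverts G. if w = snd c then
           (if snd c = snd b then 1 / of_nat (card (nb (snd c))) else 0) else 0)"
      unfolding fmat_mult_def fmat_adjoint_def grover_boundary_def
      by (rule sum.cong)
        (auto simp: out_degree_eq_card_nb divide_simps simp flip: of_real_mult)
    also have "\<dots> = (if snd c = snd b then 1 / of_nat (card (nb (snd c))) else 0)"
      using \<open>snd c \<in> pverts G\<close> pair_finite_verts by simp
    finally show ?thesis by simp
  qed
  have S: "grover_matrix G a b = ?M (y, x) b" for b
  proof -
    have "grover_matrix G a b = (\<Sum>c\<in>parcs G. if c = (y, x) then ?M c b else 0)"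
      unfolding grover_matrix_def fmat_mult_def[of "parcs G"] grover_shift_def
      by (rule sum.cong) (auto simp: xy prod_eq_iff)
    then show ?thesis using yx pair_finite_arcs by simp
  qed
  have "fmat_vec (parcs G) (grover_matrix G) \<psi> a
      = (\<Sum>b\<in>parcs G. (if snd b = x then 2 / of_nat (card (nb x)) * \<psi> b else 0)
          - (if b = (y, x) then \<psi> b else 0))"
    unfolding fmat_vec_def S M[OF yx]
    by (rule sum.cong) (auto simp: fmat_one_def algebra_simps)
  also have "\<dots> = (\<Sum>b | b \<in> parcs G \<and> snd b = x. 2 / of_nat (card (nb x)) * \<psi> b) - \<psi> (y, x)"
    using yx pair_finite_arcs by (simp add: sum_subtractf sum.inter_filter del: times_divide_eq_left)
  also have "\<dots> = step \<psi> a"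
    by (simp add: sum_ends_at step_def xy sum_distrib_left)
  finally show ?thesis .
qed

text \<open>Matrix products determine functions only on arcs, whereas \<open>step\<close> takes
  functions on all pairs.\<close>

lemma step_cong:
  assumes "\<And>b. b \<in> parcs G \<Longrightarrow> \<psi> b = \<phi> b" and "a \<in> parcs G"
  shows "step \<psi> a = step \<phi> a"
proof -
  obtain x y where a: "a = (x, y)" by (cases a)
  have "\<psi> (z, x) = \<phi> (z, x)" if "z \<in> nb x" for z
    using that by (intro assms(1)) (simp add: nb_iff arcs_symmetric)
  moreover have "\<psi> (y, x) = \<phi> (y, x)"
    using assms a by (simp add: arcs_symmetric)
  ultimately show ?thesis by (simp add: step_def a)
qed

lemma grover_power_vec:
  assumes "a \<in> parcs G"
  shows "fmat_vec (parcs G) (fmat_power (parcs G) (grover_matrix G) n) \<psi> a = (step ^^ n) \<psi> a"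
  using assms
proof (induction n arbitrary: a)
  case 0
  have "(\<Sum>b\<in>parcs G. fmat_one a b * \<psi> b) = (\<Sum>b\<in>parcs G. if a = b then \<psi> b else 0)"
    by (rule sum.cong) (auto simp: fmat_one_def)
  with 0 show ?case
    using pair_finite_arcs by (simp add: fmat_vec_def)
next
  case (Suc n)
  let ?U = "grover_matrix G" and ?P = "fmat_power (parcs G) (grover_matrix G) n"
  have "fmat_vec (parcs G) (fmat_mult (parcs G) ?U ?P) \<psi> a
      = fmat_vec (parcs G) ?U (fmat_vec (parcs G) ?P \<psi>) a"
    unfolding fmat_vec_def fmat_mult_def sum_distrib_left sum_distrib_right
    by (subst sum.swap) (simp add: mult_ac)
  also have "\<dots> = step (fmat_vec (parcs G) ?P \<psi>) a"
    using Suc.prems by (rule grover_matrix_vec)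
  also have "\<dots> = step ((step ^^ n) \<psi>) a"
    using Suc by (intro step_cong) auto
  finally show ?case by simp
qed

lemma grover_vertex_state_arc:
  assumes "u \<in> pverts G"
  shows "grover_vertex_state G u (x, y) = (if y = u then 1 / of_real (sqrt (card (nb u))) else 0)"
proof -
  have "grover_vertex_state G u (x, y) = (\<Sum>w\<in>pverts G.
      if w = u then (if y = u then 1 / of_real (sqrt (card (nb u))) else 0) else 0)"
    unfolding grover_vertex_state_def fmat_vec_def fmat_adjoint_def grover_boundary_def unit_fvec_def
    by (rule sum.cong) (auto simp: out_degree_eq_card_nb)
  then show ?thesis
    using assms pair_finite_verts by simp
qed

lemma grover_pst_iff:
  "grover_perfect_state_transfer G \<longleftrightarrow>
    (\<exists>u \<in> pverts G. \<exists>v \<in> pverts G. u \<noteq> v \<and> (\<exists>\<tau>>0. \<exists>\<gamma>. cmod \<gamma> = 1 \<and>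
      (\<forall>a \<in> parcs G. (step ^^ \<tau>) (grover_vertex_state G u) a = \<gamma> * grover_vertex_state G v a)))"
  by (simp add: grover_perfect_state_transfer_def grover_power_vec)

section \<open>Incoming sums and their three-term recursion\<close>

lemma inflow_step:
  "inflow (step \<psi>) x = (\<Sum>y\<in>nb x. 2 / of_nat (card (nb y)) * inflow \<psi> y) - (\<Sum>y\<in>nb x. \<psi> (x, y))"
  by (simp add: inflow_def step_def sum_subtractf)

text \<open>The incoming sum at \<open>x\<close> occurs once per outgoing arc with weight
  \<open>2/deg\<close>, which makes two copies; the reversed arcs take one copy away.\<close>

lemma sum_out_step:
  "(\<Sum>y\<in>nb x. step \<psi> (x, y)) = inflow \<psi> x"
  by (cases "nb x = {}") (simp_all add: step_def sum_subtractf inflow_def)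

text \<open>As \<open>inflow\<close> is \<open>N\<close> up to the factor \<open>\<surd>deg\<close>, this is the Chebyshev recursion for \<open>N U\<^sup>n N\<^sup>*\<close>.\<close>

lemma inflow_step_step:
  "inflow (step (step \<psi>)) x
    = (\<Sum>y\<in>nb x. 2 / of_nat (card (nb y)) * inflow (step \<psi>) y) - inflow \<psi> x"
  by (simp add: inflow_step[of "step \<psi>"] sum_out_step)

text \<open>First initial value of the recursion, corresponding to
  \<open>T\<^sub>0 = 1\<close>.\<close>

lemma inflow_vertex_state:
  assumes "u \<in> pverts G"
  shows "inflow (grover_vertex_state G u) x = (if x = u then of_real (sqrt (card (nb u))) else 0)"
proof -
  let ?s = "of_real (sqrt (card (nb u))) :: complex"
  have "of_nat (card (nb u)) = ?s * ?s" by (simp flip: of_real_mult)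
  with assms show ?thesis
    by (auto simp: inflow_def grover_vertex_state_arc)
qed

text \<open>Second initial value, corresponding to \<open>T\<^sub>1(A/k) = A/k\<close> in the
  regular case: with \<open>?s\<close> the root of the degree, the two terms of
  \<open>inflow_step\<close> contribute \<open>2 / ?s\<close> and \<open>- 1 / ?s\<close>.\<close>

lemma inflow_step_vertex_state:
  assumes "u \<in> pverts G"
  shows "inflow (step (grover_vertex_state G u)) x
    = (if x \<in> nb u then 1 / of_real (sqrt (card (nb u))) else 0)"
proof -
  let ?k = "of_nat (card (nb u)) :: complex" and ?s = "of_real (sqrt (card (nb u))) :: complex"
  have *: "?s * ?s = ?k" by (simp flip: of_real_mult)
  have "(\<Sum>y\<in>nb x. 2 / of_nat (card (nb y)) * inflow (grover_vertex_state G u) y)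
      = (\<Sum>y\<in>nb x. if y = u then 2 / ?k * ?s else 0)"
    using assms by (intro sum.cong) (auto simp: inflow_vertex_state)
  also have "\<dots> = (if x \<in> nb u then 2 / ?k * ?s else 0)"
    by (simp add: nb_commute[of u])
  also have "2 / ?k * ?s = 2 / ?s"
    by (cases "?s = 0") (auto simp: divide_simps simp flip: *)
  finally have 1: "(\<Sum>y\<in>nb x. 2 / of_nat (card (nb y)) * inflow (grover_vertex_state G u) y)
     = (if x \<in> nb u then 2 / ?s else 0)" .
  have "(\<Sum>y\<in>nb x. grover_vertex_state G u (x, y)) = (if x \<in> nb u then 1 / ?s else 0)"
    using assms by (simp add: grover_vertex_state_arc nb_commute[of u])
  with 1 show ?thesis
    by (simp add: inflow_step)
qed

lemma inflow_cong:
  assumes "\<And>a. a \<in> parcs G \<Longrightarrow> \<psi> a = \<phi> a"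
  shows "inflow \<psi> x = inflow \<phi> x"
  using assms by (simp add: inflow_def nb_iff arcs_symmetric)

lemma inflow_scale: "inflow (\<lambda>a. c * \<psi> a) x = c * inflow \<psi> x"
  by (simp add: inflow_def sum_distrib_left)

end

section \<open>The six-cycle\<close>

text \<open>An isomorphism record also carries maps for arcs, heads and tails. Arcs being pairs, all
  of these are forced by the vertex map \<open>f\<close>: the arc map is
  \<open>map_prod f f\<close>, and heads and tails are the projections.\<close>

lemma digraph_iso_with_proj_iff:
  assumes "pair_wf_digraph G" "pair_wf_digraph H"
  shows "digraph_iso (with_proj G) (with_proj H) \<longleftrightarrow>
    (\<exists>f. bij_betw f (pverts G) (pverts H) \<and>
      (\<forall>x\<in>pverts G. \<forall>y\<in>pverts G. (f x, f y) \<in> parcs H \<longleftrightarrow> (x, y) \<in> parcs G))"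
proof
  interpret G: pair_wf_digraph G by fact
  assume "digraph_iso (with_proj G) (with_proj H)"
  then obtain i where i: "G.digraph_isomorphism i" and H: "with_proj H = app_iso i (with_proj G)"
    by (auto simp: digraph_iso_def)
  from H have ends: "fst = iso_tail i" "snd = iso_head i"
    and V: "pverts H = iso_verts i ` pverts G" and E: "parcs H = iso_arcs i ` parcs G"
    by (metis app_iso_simps with_proj_simps)+
  from i have inj: "inj_on (iso_verts i) (pverts G)"
    and arc: "\<And>a. a \<in> parcs G \<Longrightarrow> iso_arcs i a = (iso_verts i (fst a), iso_verts i (snd a))"
    by (auto simp: G.digraph_isomorphism_def prod_eq_iff simp flip: ends)
  have "(iso_verts i x, iso_verts i y) \<in> parcs H \<longleftrightarrow> (x, y) \<in> parcs G"
    if "x \<in> pverts G" "y \<in> pverts G" for x y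
  proof
    assume "(iso_verts i x, iso_verts i y) \<in> parcs H"
    then obtain a where "a \<in> parcs G" "iso_verts i x = iso_verts i (fst a)" "iso_verts i y = iso_verts i (snd a)"
      using arc by (auto simp: E)
    then have "a = (x, y)"
      using inj that by (auto simp: inj_on_eq_iff G.arc_fst_in_verts G.arc_snd_in_verts prod_eq_iff)
    with \<open>a \<in> parcs G\<close> show "(x, y) \<in> parcs G" by simp
  next
    assume "(x, y) \<in> parcs G"
    then show "(iso_verts i x, iso_verts i y) \<in> parcs H"
      using arc by (force simp: E)
  qed
  then show "\<exists>f. bij_betw f (pverts G) (pverts H) \<and>
      (\<forall>x\<in>pverts G. \<forall>y\<in>pverts G. (f x, f y) \<in> parcs H \<longleftrightarrow> (x, y) \<in> parcs G)"
    using inj V by (auto simp: bij_betw_def)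
next
  interpret G: pair_wf_digraph G by fact
  interpret H: pair_wf_digraph H by fact
  assume "\<exists>f. bij_betw f (pverts G) (pverts H) \<and>
      (\<forall>x\<in>pverts G. \<forall>y\<in>pverts G. (f x, f y) \<in> parcs H \<longleftrightarrow> (x, y) \<in> parcs G)"
  then obtain f where f: "inj_on f (pverts G)" "f ` pverts G = pverts H"
    "\<And>x y. x \<in> pverts G \<Longrightarrow> y \<in> pverts G \<Longrightarrow> (f x, f y) \<in> parcs H \<longleftrightarrow> (x, y) \<in> parcs G"
    by (auto simp: bij_betw_def)
  let ?i = "\<lparr>iso_verts = f, iso_arcs = map_prod f f, iso_head = snd, iso_tail = fst\<rparr>"
  have "inj_on (map_prod f f) (parcs G)"
    by (rule inj_on_subset[OF map_prod_inj_on[OF f(1) f(1)]])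
      (auto dest: G.in_arcsD1 G.in_arcsD2)
  then have "G.digraph_isomorphism ?i"
    using f(1) G.wf_digraph by (simp add: G.digraph_isomorphism_def)
  moreover have "map_prod f f ` parcs G = parcs H"
  proof
    show "map_prod f f ` parcs G \<subseteq> parcs H"
      using f(3) by (auto dest: G.in_arcsD1 G.in_arcsD2)
    show "parcs H \<subseteq> map_prod f f ` parcs G"
    proof
      fix b assume b: "b \<in> parcs H"
      then obtain x y where "x \<in> pverts G" "y \<in> pverts G" "b = (f x, f y)"
        using f(2) H.arc_fst_in_verts H.arc_snd_in_verts by (metis imageE prod.collapse)
      then show "b \<in> map_prod f f ` parcs G"
        using b f(3) by force
    qed
  qed
  ultimately have "with_proj H = app_iso ?i (with_proj G)"
    using f(2) by (simp add: app_iso_def with_proj_def)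
  with \<open>G.digraph_isomorphism ?i\<close> show "digraph_iso (with_proj G) (with_proj H)"
    unfolding digraph_iso_def by blast
qed

lemma pair_wf_digraph_cycle_graph: "pair_wf_digraph (cycle_graph n)"
  by unfold_locales (auto simp: cycle_graph_def)

lemma Suc_mod_eq_iff: "Suc i mod n = Suc j mod n \<longleftrightarrow> i mod n = j mod n"
  by (auto simp: mod_Suc)

lemma six_cycle_iso:
  assumes G: "pair_graph G"
    and V: "pverts G = {g0, g1, g2, g3, g4, g5}" and dist: "distinct [g0, g1, g2, g3, g4, g5]"
    and nb: "pair_graph.nb G g0 = {g5, g1}" "pair_graph.nb G g1 = {g0, g2}"
      "pair_graph.nb G g2 = {g1, g3}" "pair_graph.nb G g3 = {g2, g4}"
      "pair_graph.nb G g4 = {g3, g5}" "pair_graph.nb G g5 = {g4, g0}"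
  shows "digraph_iso (with_proj G) (with_proj (cycle_graph 6))"
proof -
  interpret pair_graph G by fact
  \<comment> \<open>The last default, 5, is the number of \<open>g5\<close>; vertices outside the
    list never enter.\<close>
  define f where "f x = (if x = g0 then 0 else if x = g1 then 1 else if x = g2 then 2
    else if x = g3 then 3 else if x = g4 then 4 else 5 :: nat)" for x
  have f: "f g0 = 0" "f g1 = 1" "f g2 = 2" "f g3 = 3" "f g4 = 4" "f g5 = 5"
    using dist by (auto simp: f_def)
  have cycle6: "parcs (cycle_graph 6) = {(i, j). i < 6 \<and> j < 6 \<and> (j = (i + 1) mod 6 \<or> i = (j + 1) mod 6)}"
    by (simp add: cycle_graph_def)
  have ne: "g0 \<noteq> g1" "g0 \<noteq> g2" "g0 \<noteq> g3" "g0 \<noteq> g4" "g0 \<noteq> g5" "g1 \<noteq> g2" "g1 \<noteq> g3"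
    "g1 \<noteq> g4" "g1 \<noteq> g5" "g2 \<noteq> g3" "g2 \<noteq> g4" "g2 \<noteq> g5" "g3 \<noteq> g4" "g3 \<noteq> g5" "g4 \<noteq> g5"
    using dist by auto
  have "bij_betw f (pverts G) (pverts (cycle_graph 6))"
    unfolding bij_betw_def V by (auto simp: f cycle_graph_def)
  moreover have "(f x, f y) \<in> parcs (cycle_graph 6) \<longleftrightarrow> (x, y) \<in> parcs G"
    if "x \<in> pverts G" "y \<in> pverts G" for x y
  proof -
    have "(f x, f y) \<in> parcs (cycle_graph 6) \<longleftrightarrow> y \<in> nb x"
      using that ne ne[symmetric] unfolding V cycle6 insert_iff by (elim disjE emptyE) (simp_all add: f nb)
    then show ?thesis by (simp add: nb_iff)
  qed
  ultimately show ?thesis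
    using pair_wf_digraph pair_wf_digraph_cycle_graph by (auto simp: digraph_iso_with_proj_iff)
qed

section \<open>Perfect state transfer on the six-cycle\<close>

context pair_graph
begin

text \<open>At valency 2 the coin \<open>2/2 * J - I\<close> exchanges the two arcs, so amplitude
  passes straight through the vertex.\<close>

lemma step_valency_2:
  assumes "nb x = {y, z}" "y \<noteq> z"
  shows "step \<psi> (x, y) = \<psi> (z, x)"
  using assms by (simp add: step_def field_simps)

text \<open>Amplitude runs around the cycle in both directions at one edge per step, so the two
  halves of the state at \<open>h 0\<close> meet at \<open>h 3\<close> after three steps. The
  periodic numbering by all naturals turns moves around the cycle into \<open>Suc\<close>.\<close>

lemma cyclic_transfer:
  assumes h: "\<And>i. nb (h (Suc i)) = {h i, h (Suc (Suc i))}"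
    and h_eq: "\<And>i j. h i = h j \<longleftrightarrow> i mod 6 = (j::nat) mod 6"
    and V: "pverts G = range h"
  shows "grover_perfect_state_transfer G"
proof -
  have V': "h i \<in> pverts G" for i using V by simp
  have h_Suc: "h (Suc i) = h (Suc j) \<longleftrightarrow> h i = h j" for i j
    by (simp add: h_eq Suc_mod_eq_iff)
  have ne: "h i \<noteq> h (Suc (Suc i))" for i unfolding h_eq by presburger
  have forward: "step \<psi> (h (Suc i), h (Suc (Suc i))) = \<psi> (h i, h (Suc i))" for \<psi> i
    using ne[of i] by (intro step_valency_2) (auto simp: h)
  have backward: "step \<psi> (h (Suc i), h i) = \<psi> (h (Suc (Suc i)), h (Suc i))" for \<psi> i
    using ne[of i] by (intro step_valency_2) (auto simp: h)
  have card: "card (nb x) = 2" if x: "x \<in> pverts G" for x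
  proof -
    obtain i where "x = h i" using x V by blast
    \<comment> \<open>\<open>i + 5\<close> is the predecessor of \<open>i\<close> modulo 6, which
      brings the vertex into the form required by \<open>h\<close>.\<close>
    also have "h i = h (Suc (i + 5))" unfolding h_eq by presburger
    finally show ?thesis using ne[of "i + 5"] by (simp only: h) simp
  qed
  have "(step ^^ 3) (grover_vertex_state G (h 0)) a = 1 * grover_vertex_state G (h 3) a"
    if a: "a \<in> parcs G" for a
  proof -
    obtain x y where xy: "a = (x, y)" by (cases a)
    then obtain i where "x = h i" using a V arc_fst_in_verts by force
    \<comment> \<open>A full period is added, so that three predecessors are available for tracing
      the walk back.\<close>
    also have "h i = h (Suc (Suc (Suc (i + 3))))" unfolding h_eq by presburger
    finally obtain j where x: "x = h (Suc (Suc (Suc j)))" ..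
    have "y \<in> nb x" using a xy by (simp add: nb_iff)
    then consider "y = h (Suc (Suc (Suc (Suc j))))" | "y = h (Suc (Suc j))"
      unfolding x h by blast
    then show ?thesis
    proof cases
      case 1
      have "(step ^^ 3) (grover_vertex_state G (h 0)) a = grover_vertex_state G (h 0) (h j, h (Suc j))"
        unfolding xy x 1 by (simp add: numeral_3_eq_3 forward)
      moreover have "h (Suc j) = h 0 \<longleftrightarrow> y = h 3"
        unfolding 1 numeral_3_eq_3 h_Suc ..
      ultimately show ?thesis
        unfolding xy by (simp add: grover_vertex_state_arc V' card)
    next
      case 2
      have "(step ^^ 3) (grover_vertex_state G (h 0)) a
        = grover_vertex_state G (h 0)
            (h (Suc (Suc (Suc (Suc (Suc (Suc j)))))), h (Suc (Suc (Suc (Suc (Suc j))))))"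
        unfolding xy x 2 by (simp add: numeral_3_eq_3 backward)
      moreover have "h (Suc (Suc (Suc (Suc (Suc j))))) = h 0 \<longleftrightarrow> y = h 3"
      proof -
        \<comment> \<open>Replacing 0 by 6 lets three successors be cancelled on both sides.\<close>
        have "h 0 = h (Suc (Suc (Suc 3)))" unfolding h_eq by simp
        then show ?thesis unfolding 2 by (simp only: h_Suc)
      qed
      ultimately show ?thesis
        unfolding xy by (simp add: grover_vertex_state_arc V' card)
    qed
  qed
  moreover have "h 0 \<noteq> h 3" unfolding h_eq by simp
  ultimately show ?thesis
    unfolding grover_pst_iff using V'
    by (intro bexI[of _ "h 0"] bexI[of _ "h 3"] conjI exI[of _ 3] exI[of _ 1]) auto
qed

lemma six_cycle_transfer:
  assumes "digraph_iso (with_proj G) (with_proj (cycle_graph 6))"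
  shows "grover_perfect_state_transfer G"
proof -
  obtain f where f: "bij_betw f (pverts G) {..<6}"
    "\<And>x y. x \<in> pverts G \<Longrightarrow> y \<in> pverts G \<Longrightarrow> (f x, f y) \<in> parcs (cycle_graph 6) \<longleftrightarrow> (x, y) \<in> parcs G"
    using assms pair_wf_digraph pair_wf_digraph_cycle_graph
    by (auto simp: digraph_iso_with_proj_iff cycle_graph_def)
  \<comment> \<open>The numbering given by the isomorphism, inverted and continued with period
    6.\<close>
  define h where "h i = inv_into (pverts G) f (i mod 6)" for i
  have hV: "h i \<in> pverts G" for i
    unfolding h_def using f(1) by (intro inv_into_into) (simp add: bij_betw_def)
  have fh: "f (h i) = i mod 6" for i
    unfolding h_def using f(1) by (intro f_inv_into_f) (simp add: bij_betw_def)
  have hf: "h (f x) = x" and f_less: "f x < 6" if "x \<in> pverts G" for x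
  proof -
    show "f x < 6" using f(1) that by (auto simp: bij_betw_def)
    then show "h (f x) = x"
      unfolding h_def using f(1) that by (simp add: bij_betw_def)
  qed
  have h_eq: "h i = h j \<longleftrightarrow> i mod 6 = j mod 6" for i j
    using fh by (metis h_def)
  show ?thesis
  proof (rule cyclic_transfer)
    show "nb (h (Suc i)) = {h i, h (Suc (Suc i))}" for i
    proof -
      have "y \<in> nb (h (Suc i)) \<longleftrightarrow> y = h i \<or> y = h (Suc (Suc i))" if y: "y \<in> pverts G" for y
      proof -
        have "y \<in> nb (h (Suc i)) \<longleftrightarrow> (Suc i mod 6, f y) \<in> parcs (cycle_graph 6)"
          using f(2)[OF hV y] fh by (simp add: nb_iff)
        also have "\<dots> \<longleftrightarrow> f y = (Suc i mod 6 + 1) mod 6 \<or> Suc i mod 6 = (f y + 1) mod 6"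
          using f_less[OF y] by (simp add: cycle_graph_def)
        also have "\<dots> \<longleftrightarrow> f y mod 6 = i mod 6 \<or> f y mod 6 = Suc (Suc i) mod 6"
          using f_less[OF y] Suc_mod_eq_iff[of i 6 "f y"] by (auto simp: mod_Suc_eq)
        also have "\<dots> \<longleftrightarrow> y = h i \<or> y = h (Suc (Suc i))"
          unfolding h_eq[symmetric] hf[OF y] ..
        finally show ?thesis .
      qed
      then show ?thesis using nb_subset hV by blast
    qed
    show "pverts G = range h" using hV hf by (metis image_subset_iff rangeI subsetI subset_antisym)
  qed (rule h_eq)
qed

end

section \<open>Perfect state transfer on distance-regular graphs\<close>

locale distance_regular_graph = pair_graph G for G :: "'a pair_pre_digraph" +
  assumes distance_regular: "distance_regular G"
begin

section \<open>Graph distance as a metric\<close>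

lemma ex_awalk:
  assumes "u \<in> pverts G" "v \<in> pverts G"
  shows "\<exists>p. awalk u p v"
proof -
  have "connected (with_proj G)" using distance_regular by (simp add: distance_regular_def)
  then have "u \<rightarrow>\<^sup>*\<^bsub>with_proj (mk_symmetric G)\<^esub> v"
    using assms by (auto simp: connected_def strongly_connected_def)
  then show ?thesis
    \<comment> \<open>Connectedness refers to the symmetric closure, which has the same reachability
      because the arc set is already symmetric.\<close>
    using reachable_mk_symmetric_eq[OF sym_arcs] by (simp add: reachable_awalk)
qed

lemma verts_nonempty: "pverts G \<noteq> {}"
  using distance_regular by (auto simp: distance_regular_def connected_def strongly_connected_def)

lemma ex_shortest_awalk:
  assumes "u \<in> pverts G" "v \<in> pverts G"
  obtains p where "awalk u p v" "length p = d u v"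
proof -
  obtain q where "awalk u q v" using ex_awalk[OF assms] by blast
  then have "\<exists>p. awalk u p v \<and> length p = d u v"
    unfolding graph_dist_def by (intro LeastI) blast
  then show thesis using that by blast
qed

lemma dist_le_length: "awalk u p v \<Longrightarrow> d u v \<le> length p"
  unfolding graph_dist_def by (rule Least_le) blast

lemma dist_eq_0_iff:
  assumes "u \<in> pverts G" "v \<in> pverts G"
  shows "d u v = 0 \<longleftrightarrow> u = v"
proof
  assume "d u v = 0"
  then show "u = v" using ex_shortest_awalk[OF assms] by (metis awalk_Nil_iff length_0_conv)
next
  assume "u = v"
  then show "d u v = 0" using dist_le_length[of u "[]" v] assms by (simp add: awalk_Nil_iff)
qed

lemma dist_triangle:
  assumes "u \<in> pverts G" "v \<in> pverts G" "w \<in> pverts G"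
  shows "d u w \<le> d u v + d v w"
proof -
  obtain p where "awalk u p v" "length p = d u v"
    using assms(1,2) by (rule ex_shortest_awalk)
  moreover obtain q where "awalk v q w" "length q = d v w"
    using assms(2,3) by (rule ex_shortest_awalk)
  ultimately show ?thesis
    using dist_le_length[of u "p @ q" w] awalk_appendI[of u p v q w] by simp
qed

lemma dist_commute:
  assumes "u \<in> pverts G" "v \<in> pverts G"
  shows "d u v = d v u"
proof -
  have "d y x \<le> d x y" if xy: "x \<in> pverts G" "y \<in> pverts G" for x y
  proof -
    obtain p where p: "awalk x p y" "length p = d x y"
      using ex_shortest_awalk[OF xy] by blast
    have "length (rev_path p) = length p" by (induction p) auto
    then show ?thesis using p dist_le_length[of y "rev_path p" x] by simp
  qed
  then show ?thesis using assms by (simp add: le_antisym)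
qed

text \<open>The second vertex of a shortest walk works: a shorter walk from it to \<open>v\<close>
  would shorten the whole walk.\<close>

lemma dist_SucE:
  assumes "u \<in> pverts G" "v \<in> pverts G" "d u v = Suc n"
  obtains w where "w \<in> nb u" "d w v = n"
proof -
  obtain p where p: "awalk u p v" "length p = Suc n"
    using assms ex_shortest_awalk by metis
  then obtain w q where q: "p = (u, w) # q" "(u, w) \<in> parcs G" "awalk w q v"
    by (cases p) (auto simp: awalk_Cons_iff)
  have "d w v \<le> n" using q p dist_le_length by fastforce
  moreover have "d u v \<le> Suc (d w v)"
  proof -
    obtain r where "awalk w r v" "length r = d w v"
      using q assms ex_shortest_awalk in_arcsD2 by metis
    then show ?thesis
      using q dist_le_length[of u "(u, w) # r" v] by (auto simp: awalk_Cons_iff in_arcsD1)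
  qed
  ultimately show thesis using that q assms by (auto simp: nb_iff)
qed

lemma dist_eq_1_iff:
  assumes "u \<in> pverts G" "v \<in> pverts G"
  shows "d u v = 1 \<longleftrightarrow> v \<in> nb u"
proof
  assume "d u v = 1"
  then obtain w where "w \<in> nb u" "d w v = 0"
    using dist_SucE[OF assms] by auto
  then show "v \<in> nb u"
    using assms dist_eq_0_iff nb_in_verts by blast
next
  assume v: "v \<in> nb u"
  then have "d u v \<le> 1"
    using dist_le_length[of u "[(u, v)]" v] assms by (simp add: awalk_Cons_iff awalk_Nil_iff nb_iff)
  moreover have "d u v \<noteq> 0" using v assms dist_eq_0_iff by auto
  ultimately show "d u v = 1" by simp
qed

lemma dist_nb_le:
  assumes "w \<in> nb v" "u \<in> pverts G"
  shows "d u w \<le> Suc (d u v)"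
  using dist_triangle[of u v w] dist_eq_1_iff[of v w] assms nb_in_verts[OF assms(1)] by simp

lemma nb_conv_dist:
  assumes "u \<in> pverts G"
  shows "nb u = {w \<in> pverts G. d u w = 1}"
  using assms dist_eq_1_iff nb_subset by blast

section \<open>Intersection numbers and functions constant on spheres\<close>

lemma card_sphere_Int:
  assumes "u \<in> pverts G" "v \<in> pverts G" "u' \<in> pverts G" "v' \<in> pverts G" "d u v = d u' v'"
  shows "card {w \<in> pverts G. d u w = i \<and> d v w = j} = card {w \<in> pverts G. d u' w = i \<and> d v' w = j}"
proof -
  obtain c :: "nat \<Rightarrow> nat \<Rightarrow> nat \<Rightarrow> nat" where
    "\<And>x y i j. x \<in> pverts G \<Longrightarrow> y \<in> pverts G \<Longrightarrow>
      card {w \<in> pverts G. d x w = i \<and> d y w = j} = c i j (d x y)"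
    using distance_regular unfolding distance_regular_def by blast
  with assms show ?thesis by simp
qed

lemma card_sphere:
  assumes "u \<in> pverts G" "v \<in> pverts G"
  shows "card {w \<in> pverts G. d u w = i} = card {w \<in> pverts G. d v w = i}"
  using card_sphere_Int[of u u v v i i] assms dist_eq_0_iff[of u u] dist_eq_0_iff[of v v] by simp

lemma card_nb_eq:
  assumes "u \<in> pverts G" "v \<in> pverts G"
  shows "card (nb u) = card (nb v)"
  using card_sphere[of u v 1] assms by (simp add: nb_conv_dist)

text \<open>The neighbours of \<open>v\<close> at distance \<open>i\<close> from \<open>u\<close>
  are counted by an intersection number depending only on \<open>d u v\<close>; being nonzero for
  one pair, it is nonzero for the other.\<close>

lemma ex_nb_at_dist:
  assumes "u \<in> pverts G" "v \<in> pverts G" "u' \<in> pverts G" "v' \<in> pverts G" "d u v = d u' v'"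
    and "w \<in> nb v" "d u w = i"
  obtains w' where "w' \<in> nb v'" "d u' w' = i"
proof -
  have "w \<in> {w \<in> pverts G. d u w = i \<and> d v w = 1}"
    using assms(2,6,7) by (simp add: nb_conv_dist)
  then have "card {w \<in> pverts G. d u w = i \<and> d v w = 1} \<noteq> 0"
    using pair_finite_verts by auto
  then have "{w \<in> pverts G. d u' w = i \<and> d v' w = 1} \<noteq> {}"
    unfolding card_sphere_Int[OF assms(1-5), of i 1] by (metis card.empty)
  then obtain w' where "w' \<in> pverts G" "d u' w' = i" "d v' w' = 1" by blast
  then show thesis using that assms(4) by (simp add: nb_conv_dist)
qed

text \<open>Adjacency preserves functions of the distance to \<open>u\<close>: neighbours grouped by
  that distance form classes whose sizes are intersection numbers.\<close>

lemma sum_nb_dist: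
  fixes F :: "'a \<Rightarrow> complex"
  assumes "u \<in> pverts G" "x \<in> pverts G" "x' \<in> pverts G" "d u x = d u x'"
    and F: "\<And>y y'. y \<in> pverts G \<Longrightarrow> y' \<in> pverts G \<Longrightarrow> d u y = d u y' \<Longrightarrow> F y = F y'"
  shows "sum F (nb x) = sum F (nb x')"
proof -
  \<comment> \<open>\<open>f\<close> reads off the value of \<open>F\<close> on a sphere from an
    arbitrary representative; it is evaluated only at distances that occur.\<close>
  define f where "f i = F (SOME y. y \<in> pverts G \<and> d u y = i)" for i
  have f: "F y = f (d u y)" if "y \<in> pverts G" for y
    unfolding f_def using someI[of "\<lambda>z. z \<in> pverts G \<and> d u z = d u y" y] that by (intro F) auto
  have *: "sum F (nb x)
    = (\<Sum>j\<in>d u ` pverts G. of_nat (card {w \<in> pverts G. d u w = j \<and> d x w = 1}) * f j)"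
    if x: "x \<in> pverts G" for x
  proof -
    have "sum F (nb x) = (\<Sum>j\<in>d u ` pverts G. \<Sum>y | y \<in> nb x \<and> d u y = j. F y)"
      using pair_finite_verts nb_subset by (intro sum.group[symmetric]) auto
    also have "\<dots> = (\<Sum>j\<in>d u ` pverts G. of_nat (card {w \<in> pverts G. d u w = j \<and> d x w = 1}) * f j)"
    proof (rule sum.cong)
      fix j
      have "{y. y \<in> nb x \<and> d u y = j} = {w \<in> pverts G. d u w = j \<and> d x w = 1}"
        using x by (auto simp: nb_conv_dist)
      then show "(\<Sum>y | y \<in> nb x \<and> d u y = j. F y)
          = of_nat (card {w \<in> pverts G. d u w = j \<and> d x w = 1}) * f j"
        by (simp add: f)
    qed simp
    finally show ?thesis .
  qed
  show ?thesis
    unfolding *[OF assms(2)] *[OF assms(3)] card_sphere_Int[OF assms(1,2,1,3,4)] ..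
qed

text \<open>Up to the factor \<open>\<surd>k\<close>, the column \<open>T\<^sub>n(A/k) e\<^sub>u\<close>.\<close>

abbreviation walk :: "'a \<Rightarrow> nat \<Rightarrow> 'a \<Rightarrow> complex" where
  "walk u n \<equiv> inflow ((step ^^ n) (grover_vertex_state G u))"

lemma walk_Suc_Suc:
  assumes "u \<in> pverts G" "x \<in> pverts G"
  shows "walk u (Suc (Suc n)) x = 2 / of_nat (card (nb u)) * (\<Sum>y\<in>nb x. walk u (Suc n) y) - walk u n x"
proof -
  have "card (nb y) = card (nb u)" if "y \<in> nb x" for y
    using card_nb_eq[of y u] nb_in_verts(2)[OF that] assms(1) by simp
  then show ?thesis
    by (simp add: inflow_step_step sum_distrib_left)
qed

text \<open>Both initial vectors are functions of the distance to \<open>u\<close>, and the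
  three-term recursion keeps this property by \<open>sum_nb_dist\<close>.\<close>

lemma walk_dist:
  assumes u: "u \<in> pverts G"
  shows "x \<in> pverts G \<Longrightarrow> x' \<in> pverts G \<Longrightarrow> d u x = d u x' \<Longrightarrow> walk u n x = walk u n x'"
proof (induction n arbitrary: x x' rule: induct_nat_012)
  case 0
  then have "x = u \<longleftrightarrow> x' = u" using u dist_eq_0_iff by metis
  then show ?case using u by (simp add: inflow_vertex_state)
next
  case 1
  then have "x \<in> nb u \<longleftrightarrow> x' \<in> nb u" using u by (simp add: nb_conv_dist)
  then show ?case using u by (simp add: inflow_step_vertex_state)
next
  case (ge2 n)
  have "(\<Sum>y\<in>nb x. walk u (Suc n) y) = (\<Sum>y\<in>nb x'. walk u (Suc n) y)"
    using u ge2.prems ge2.IH(2) by (rule sum_nb_dist)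
  with ge2.IH(1)[OF ge2.prems] show ?case
    unfolding walk_Suc_Suc[OF u ge2.prems(1)] walk_Suc_Suc[OF u ge2.prems(2)] by simp
qed

lemma walk_transfer:
  assumes "v \<in> pverts G"
    and "\<And>a. a \<in> parcs G \<Longrightarrow> (step ^^ \<tau>) (grover_vertex_state G u) a = \<gamma> * grover_vertex_state G v a"
  shows "walk u \<tau> x = (if x = v then \<gamma> * of_real (sqrt (card (nb v))) else 0)"
proof -
  have "walk u \<tau> x = \<gamma> * inflow (grover_vertex_state G v) x"
    using inflow_cong[OF assms(2)] by (simp only: inflow_scale)
  then show ?thesis using assms(1) by (simp add: inflow_vertex_state)
qed

lemma card_nb_pos:
  assumes "u \<in> pverts G" "v \<in> pverts G" "u \<noteq> v"
  shows "card (nb u) > 0"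
proof -
  obtain n where "d u v = Suc n" using assms dist_eq_0_iff not0_implies_Suc by metis
  then obtain w where "w \<in> nb u" using dist_SucE[OF assms(1,2)] by metis
  then show ?thesis by (auto simp: card_gt_0_iff)
qed

text \<open>At time \<open>\<tau>\<close> the vector \<open>walk u \<tau>\<close> is constant on
  spheres around \<open>u\<close>, yet nonzero at \<open>v\<close> and zero at every other
  vertex.\<close>

lemma transfer_sphere:
  assumes uv: "u \<in> pverts G" "v \<in> pverts G" "u \<noteq> v" and \<gamma>: "cmod \<gamma> = 1"
    and pst: "\<And>a. a \<in> parcs G \<Longrightarrow> (step ^^ \<tau>) (grover_vertex_state G u) a = \<gamma> * grover_vertex_state G v a"
  shows "{w \<in> pverts G. d u w = d u v} = {v}"
proof -
  have "w = v" if w: "w \<in> pverts G" "d u w = d u v" for w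
  proof (rule ccontr)
    assume "w \<noteq> v"
    then have "walk u \<tau> w = 0" using walk_transfer[OF uv(2) pst] by simp
    moreover have "walk u \<tau> w = walk u \<tau> v" using uv w by (intro walk_dist)
    moreover have "walk u \<tau> v \<noteq> 0"
      using walk_transfer[OF uv(2) pst] \<gamma> card_nb_pos[of v u] uv by auto
    ultimately show False by simp
  qed
  then show ?thesis using uv by auto
qed

lemma dist_le_diameter:
  assumes "u \<in> pverts G" "v \<in> pverts G"
  shows "d u v \<le> graph_diameter G"
proof -
  have "{d u v |u v. u \<in> pverts G \<and> v \<in> pverts G} = case_prod d ` (pverts G \<times> pverts G)" by auto
  then show ?thesis
    using assms pair_finite_verts unfolding graph_diameter_def by (intro Max_ge) auto
qed

lemma diameter_attained:
  obtains u v where "u \<in> pverts G" "v \<in> pverts G" "d u v = graph_diameter G"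
proof -
  have "{d u v |u v. u \<in> pverts G \<and> v \<in> pverts G} = case_prod d ` (pverts G \<times> pverts G)" by auto
  then have "graph_diameter G \<in> {d u v |u v. u \<in> pverts G \<and> v \<in> pverts G}"
    using verts_nonempty pair_finite_verts unfolding graph_diameter_def by (intro Max_in) auto
  then show thesis using that by auto
qed

end

section \<open>Singleton spheres in diameter 3\<close>

locale distance_regular_graph_diameter_3 = distance_regular_graph +
  assumes diameter: "graph_diameter G = 3"
begin

lemma geodesic:
  obtains x0 x1 x2 x3 where "x0 \<in> pverts G" "x1 \<in> nb x0" "x2 \<in> nb x1" "x3 \<in> nb x2" "d x0 x3 = 3"
    "d x0 x2 = 2" "d x1 x3 = 2"
proof -
  obtain x0 x3 where x: "x0 \<in> pverts G" "x3 \<in> pverts G" "d x0 x3 = 3"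
    using diameter_attained diameter by metis
  then obtain x1 where x1: "x1 \<in> nb x0" "d x1 x3 = 2"
    using dist_SucE[of x0 x3 2] by auto
  then obtain x2 where x2: "x2 \<in> nb x1" "d x2 x3 = 1"
    using dist_SucE[of x1 x3 1] x nb_in_verts by auto
  have "x3 \<in> nb x2" using x2 x dist_eq_1_iff nb_in_verts by blast
  moreover have "d x0 x2 = 2"
    using dist_nb_le[OF \<open>x3 \<in> nb x2\<close>, of x0] dist_nb_le[OF x2(1), of x0] x x1 dist_eq_1_iff[of x0 x1] nb_in_verts[OF x1(1)] by simp
  ultimately show thesis using that x x1 x2 by blast
qed

text \<open>For \<open>d u v = 2\<close>, every neighbour of the start \<open>x0\<close> of a geodesic of length 3 is adjacent to \<open>x2\<close>,
  the only vertex at distance 2; by regularity \<open>nb x0 = nb x2\<close>, which contains \<open>x3\<close>.\<close>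

lemma singleton_sphere_dist:
  assumes uv: "u \<in> pverts G" "v \<in> pverts G" "u \<noteq> v" and s: "card {w \<in> pverts G. d u w = d u v} = 1"
  shows "d u v = 3"
proof -
  obtain x0 x1 x2 x3 where x: "x0 \<in> pverts G" "x1 \<in> nb x0" "x2 \<in> nb x1" "x3 \<in> nb x2" "d x0 x3 = 3"
    "d x0 x2 = 2" "d x1 x3 = 2" by (rule geodesic)
  have V: "x1 \<in> pverts G" "x2 \<in> pverts G" "x3 \<in> pverts G" using x nb_in_verts by blast+
  have sphere: "a = b" if "y \<in> pverts G" "a \<in> pverts G" "b \<in> pverts G" "d y a = d u v" "d y b = d u v" for y a b
  proof -
    have "card {w \<in> pverts G. d y w = d u v} = 1"
      using card_sphere[of y u] that uv s by simp
    then obtain c where "{w \<in> pverts G. d y w = d u v} = {c}" by (rule card_1_singletonE)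
    moreover have "a \<in> {w \<in> pverts G. d y w = d u v}" "b \<in> {w \<in> pverts G. d y w = d u v}"
      using that by simp_all
    ultimately show ?thesis by simp
  qed
  have "d u v \<noteq> 0" using uv dist_eq_0_iff by simp
  moreover have "d u v \<noteq> 1"
  proof
    assume "d u v = 1"
    \<comment> \<open>The inner vertex \<open>x1\<close> of the geodesic has both \<open>x0\<close>
      and \<open>x2\<close> as neighbours.\<close>
    then have "x0 = x2" using sphere[of x1 x0 x2] x V dist_eq_1_iff[of x1] nb_commute by auto
    then show False using x V dist_eq_0_iff[of x0 x0] by simp
  qed
  moreover have "d u v \<noteq> 2"
  proof
    assume 2: "d u v = 2"
    have "z \<in> nb x2" if z: "z \<in> nb x0" for z
    proof -
      have zV: "z \<in> pverts G" using z nb_in_verts by blast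
      have "d x0 x1 = d x0 z" using z x(1,2) V(1) zV dist_eq_1_iff by metis
      then obtain y where y: "y \<in> nb z" "d x0 y = 2"
        using ex_nb_at_dist[of x0 x1 x0 z x2 2] x V zV by blast
      then have "y = x2" using sphere[of x0 y x2] x V 2 nb_in_verts by auto
      then show ?thesis using y nb_commute by blast
    qed
    then have "nb x0 = nb x2"
      using card_nb_eq[of x0 x2] x V by (intro card_subset_eq) auto
    then have "d x0 x3 = 1" using x V dist_eq_1_iff by blast
    with x show False by simp
  qed
  moreover have "d u v \<le> 3" using dist_le_diameter uv diameter by metis
  ultimately show ?thesis by linarith
qed

end

section \<open>Antipodal double covers of complete graphs\<close>

locale antipodal_3 = distance_regular_graph_diameter_3 +
  assumes card_antipodes: "x \<in> pverts G \<Longrightarrow> card {w \<in> pverts G. d x w = 3} = 1"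
begin

lemma antipode_unique:
  assumes "x \<in> pverts G" "a \<in> pverts G" "b \<in> pverts G" "d x a = 3" "d x b = 3"
  shows "a = b"
proof -
  obtain c where "{w \<in> pverts G. d x w = 3} = {c}"
    using card_antipodes assms(1) by (metis card_1_singletonE)
  moreover have "a \<in> {w \<in> pverts G. d x w = 3}" "b \<in> {w \<in> pverts G. d x w = 3}"
    using assms by simp_all
  ultimately show ?thesis by simp
qed

lemma antipode_exists:
  assumes "x \<in> pverts G"
  obtains a where "a \<in> pverts G" "d x a = 3"
proof -
  obtain c where "{w \<in> pverts G. d x w = 3} = {c}"
    using card_antipodes assms(1) by (metis card_1_singletonE)
  then show thesis using that by blast
qed

text \<open>Adjacency, a common neighbour or equality would each force distance at most 2.\<close>

lemma nb_antipodes_disjoint: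
  assumes "u \<in> pverts G" "v \<in> pverts G" "d u v = 3"
  shows "u \<notin> nb v" "v \<notin> nb u" "nb u \<inter> nb v = {}" "u \<noteq> v"
proof -
  show "v \<notin> nb u" using assms dist_eq_1_iff[of u v] by auto
  then show "u \<notin> nb v" using nb_commute by blast
  show "u \<noteq> v" using assms dist_eq_0_iff[of u v] by auto
  show "nb u \<inter> nb v = {}"
  proof (rule ccontr)
    assume "nb u \<inter> nb v \<noteq> {}"
    then obtain x where x: "x \<in> nb u" "x \<in> nb v" by blast
    then have "v \<in> nb x" "x \<in> pverts G" using nb_commute nb_in_verts by blast+
    then show False using dist_nb_le[of v x u] x assms dist_eq_1_iff[of u x] by simp
  qed
qed

text \<open>A vertex at distance 2 from \<open>u\<close> has a neighbour at distance 3 from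
  \<open>u\<close>, as the third vertex of a geodesic does; by uniqueness that neighbour is
  \<open>v\<close>.\<close>

lemma verts_antipodes:
  assumes uv: "u \<in> pverts G" "v \<in> pverts G" "d u v = 3"
  shows "pverts G = {u, v} \<union> nb u \<union> nb v"
proof
  show "{u, v} \<union> nb u \<union> nb v \<subseteq> pverts G" using uv nb_subset by blast
  show "pverts G \<subseteq> {u, v} \<union> nb u \<union> nb v"
  proof
    fix x assume x: "x \<in> pverts G"
    have "d u x \<le> 3" using dist_le_diameter[of u x] uv x diameter by simp
    then consider "d u x = 0" | "d u x = 1" | "d u x = 2" | "d u x = 3" by linarith
    then show "x \<in> {u, v} \<union> nb u \<union> nb v"
    proof cases
      case 3
      obtain x0 x1 x2 x3 where p: "x0 \<in> pverts G" "x1 \<in> nb x0" "x2 \<in> nb x1" "x3 \<in> nb x2" "d x0 x3 = 3"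
        "d x0 x2 = 2" by (rule geodesic)
      have "x2 \<in> pverts G" using p nb_in_verts by blast
      with p 3 uv x obtain y where y: "y \<in> nb x" "d u y = 3"
        using ex_nb_at_dist[of x0 x2 u x x3 3] by metis
      then have "y = v" using antipode_unique uv nb_in_verts by metis
      then show ?thesis using y nb_commute by blast
    qed (use uv x dist_eq_0_iff dist_eq_1_iff antipode_unique in auto)
  qed
qed

text \<open>In matrix form, \<open>A + I\<close> maps the indicator of an antipodal pair to the
  all-ones vector, because the pair and its two neighbourhoods partition the vertices.\<close>

lemma antipodal_indicator:
  assumes "u \<in> pverts G" "v \<in> pverts G" "d u v = 3" "x \<in> pverts G"
  shows "of_bool (x \<in> nb u) + of_bool (x \<in> nb v) + of_bool (x = u) + of_bool (x = v) = (1::complex)"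
  using assms(4) nb_antipodes_disjoint[OF assms(1-3)] verts_antipodes[OF assms(1-3)]
  by (auto simp: of_bool_def)

lemma sum_nb_of_bool: "(\<Sum>z\<in>nb x. of_bool (z = u)) = (of_bool (x \<in> nb u) :: complex)"
  using nb_commute[of u x] by (auto simp: of_bool_def)

text \<open>\<open>A + I\<close> sends the indicators of both antipodal pairs to the same all-ones
  vector, hence annihilates their difference.\<close>

lemma antipodal_eigenvector:
  assumes "u \<in> pverts G" "v \<in> pverts G" "d u v = 3"
    and "w \<in> pverts G" "w' \<in> pverts G" "d w w' = 3"
    and "x \<in> pverts G"
  defines "y \<equiv> \<lambda>z. of_bool (z = u) + of_bool (z = v) - of_bool (z = w) - of_bool (z = w') :: complex"
  shows "sum y (nb x) = - y x"
  using antipodal_indicator[OF assms(1-3,7)] antipodal_indicator[OF assms(4-6,7)]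
  unfolding y_def sum_subtractf sum.distrib sum_nb_of_bool by (simp add: algebra_simps)

text \<open>Pairing \<open>walk u n\<close> with a \<open>-1\<close>-eigenvector \<open>y\<close>
  satisfying \<open>y u = y v = 1\<close> yields, after normalisation, the Chebyshev value at
  \<open>-1/k\<close>; at time \<open>\<tau>\<close> the transfer turns it into
  \<open>\<gamma>\<close>.\<close>

lemma transfer_valency:
  assumes uv: "u \<in> pverts G" "v \<in> pverts G" "d u v = 3" and \<gamma>: "cmod \<gamma> = 1" and \<tau>: "\<tau> > 0"
    and pst: "\<And>a. a \<in> parcs G \<Longrightarrow> (step ^^ \<tau>) (grover_vertex_state G u) a = \<gamma> * grover_vertex_state G v a"
  shows "card (nb u) = 2"
proof -
  define k where "k = card (nb u)"
  have ne: "u \<notin> nb v" "u \<noteq> v" using nb_antipodes_disjoint[OF uv] by auto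
  have k: "k > 0" unfolding k_def using card_nb_pos uv ne by blast
  \<comment> \<open>The second antipodal pair starts at a neighbour of \<open>u\<close>; it avoids
    \<open>u\<close> and \<open>v\<close>, so its negative entries do not disturb \<open>y\<close>
    there.\<close>
  obtain w where wu: "w \<in> nb u" using k by (auto simp: k_def card_gt_0_iff)
  then have w: "w \<in> pverts G" "w \<noteq> u" "w \<noteq> v"
    using nb_in_verts nb_antipodes_disjoint[OF uv] by auto
  obtain w' where w': "w' \<in> pverts G" "d w w' = 3" using antipode_exists w(1) by blast
  have "w' \<noteq> u" using w' wu w uv dist_eq_1_iff[of w u] nb_commute[of w u] by auto
  moreover have "w' \<noteq> v"
    using antipode_unique[of v u w] w' w uv dist_commute by auto
  define y where "y z = (of_bool (z = u) + of_bool (z = v) - of_bool (z = w) - of_bool (z = w') :: complex)" for z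
  have y: "sum y (nb x) = - y x" if "x \<in> pverts G" for x
    using antipodal_eigenvector[OF uv w(1) w' that] by (simp add: y_def)
  have yuv: "y u = 1" "y v = 1"
    using ne w \<open>w' \<noteq> u\<close> \<open>w' \<noteq> v\<close> by (auto simp: y_def)
  define s where "s = complex_of_real (sqrt k)"
  have s: "s * s = of_nat k" "s \<noteq> 0"
    using k by (auto simp: s_def simp flip: of_real_mult)
  define r where "r n = (\<Sum>x\<in>pverts G. walk u n x * y x) / s" for n
  have "r 0 = 1"
  proof -
    have "(\<Sum>x\<in>pverts G. walk u 0 x * y x) = (\<Sum>x\<in>pverts G. if x = u then s * y u else 0)"
      using uv by (intro sum.cong) (auto simp: inflow_vertex_state s_def k_def)
    then show ?thesis using uv pair_finite_verts s yuv by (simp add: r_def)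
  qed
  moreover have "r (Suc 0) = - 1 / of_nat k"
  proof -
    have "(\<Sum>x\<in>pverts G. walk u (Suc 0) x * y x) = (\<Sum>x\<in>pverts G. if x \<in> nb u then y x / s else 0)"
      using uv by (intro sum.cong) (auto simp: inflow_step_vertex_state s_def k_def)
    also have "\<dots> = (\<Sum>x\<in>nb u. y x / s)"
      using pair_finite_verts nb_subset by (simp add: sum.If_cases Int_absorb1)
    also have "\<dots> = - 1 / s"
      using uv y yuv by (simp flip: sum_divide_distrib)
    finally show ?thesis by (simp add: r_def flip: s)
  qed
  moreover have "r (Suc (Suc n)) = - 2 / of_nat k * r (Suc n) - r n" for n
  proof -
    \<comment> \<open>The adjacency operator is symmetric, so it moves across the pairing from the
      walk to \<open>y\<close>, where it acts as \<open>-1\<close>.\<close>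
    have "(\<Sum>x\<in>pverts G. (\<Sum>z\<in>nb x. walk u (Suc n) z) * y x)
      = (\<Sum>x\<in>pverts G. \<Sum>z | z \<in> pverts G \<and> z \<in> nb x. walk u (Suc n) z * y x)"
      unfolding sum_distrib_right using nb_subset by (intro sum.cong) auto
    also have "\<dots> = (\<Sum>z\<in>pverts G. \<Sum>x | x \<in> pverts G \<and> z \<in> nb x. walk u (Suc n) z * y x)"
      using pair_finite_verts pair_finite_verts by (rule sum.swap_restrict)
    also have "\<dots> = (\<Sum>z\<in>pverts G. walk u (Suc n) z * sum y (nb z))"
      unfolding sum_distrib_left
      by (intro sum.cong) (use nb_subset nb_commute in auto)
    also have "\<dots> = - (\<Sum>z\<in>pverts G. walk u (Suc n) z * y z)"
      unfolding sum_negf[symmetric] by (intro sum.cong) (auto simp: y)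
    finally have *: "(\<Sum>x\<in>pverts G. (\<Sum>z\<in>nb x. walk u (Suc n) z) * y x)
      = - (\<Sum>z\<in>pverts G. walk u (Suc n) z * y z)" .
    have "(\<Sum>x\<in>pverts G. walk u (Suc (Suc n)) x * y x)
      = (\<Sum>x\<in>pverts G. 2 / of_nat k * ((\<Sum>z\<in>nb x. walk u (Suc n) z) * y x) - walk u n x * y x)"
      unfolding k_def
      by (intro sum.cong refl) (simp only: walk_Suc_Suc[OF uv(1)] left_diff_distrib mult.assoc)
    also have "\<dots> = 2 / of_nat k * (\<Sum>x\<in>pverts G. (\<Sum>z\<in>nb x. walk u (Suc n) z) * y x)
        - (\<Sum>x\<in>pverts G. walk u n x * y x)"
      unfolding sum_subtractf sum_distrib_left ..
    finally show ?thesis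
      unfolding * r_def using s by (simp add: field_simps)
  qed
  moreover have "cmod (r \<tau>) = 1"
  proof -
    have "(\<Sum>x\<in>pverts G. walk u \<tau> x * y x) = (\<Sum>x\<in>pverts G. if x = v then \<gamma> * s * y v else 0)"
      using uv card_nb_eq[of u v]
      by (intro sum.cong) (auto simp: walk_transfer[OF uv(2) pst] s_def k_def)
    then show ?thesis using uv pair_finite_verts s yuv \<gamma> by (simp add: r_def)
  qed
  ultimately have "k \<le> 2"
    using cheb_recurrence_unimodular k \<tau> by blast
  \<comment> \<open>An inner vertex of a geodesic has two distinct neighbours, and the graph is
    regular.\<close>
  moreover have "k \<noteq> 1"
  proof -
    obtain x0 x1 x2 x3 where x: "x0 \<in> pverts G" "x1 \<in> nb x0" "x2 \<in> nb x1" "d x0 x2 = 2"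
      by (rule geodesic)
    then have "{x0, x2} \<subseteq> nb x1" "x0 \<noteq> x2"
      using nb_commute dist_eq_0_iff[of x0 x0] by auto
    then have "2 \<le> card (nb x1)" by (metis card_2_iff card_mono finite_nb)
    then show ?thesis using card_nb_eq[of u x1] uv x nb_in_verts by (auto simp: k_def)
  qed
  ultimately show ?thesis using k unfolding k_def by linarith
qed

text \<open>A geodesic from \<open>u\<close> to its antipode \<open>v\<close> is one half of the
  hexagon. The remaining neighbours \<open>g5\<close> of \<open>u\<close> and \<open>g4\<close> of
  \<open>v\<close> exhaust the vertices, and the only edge left is the one joining them.\<close>

lemma valency_2_iso:
  assumes 2: "\<And>x. x \<in> pverts G \<Longrightarrow> card (nb x) = 2"
  shows "digraph_iso (with_proj G) (with_proj (cycle_graph 6))"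
proof -
  obtain u g1 g2 v where g: "u \<in> pverts G" "g1 \<in> nb u" "g2 \<in> nb g1" "v \<in> nb g2" "d u v = 3"
    "d u g2 = 2" "d g1 v = 2" by (rule geodesic)
  have V: "g1 \<in> pverts G" "g2 \<in> pverts G" "v \<in> pverts G" using g nb_in_verts by blast+
  have other: "\<exists>z. z \<noteq> y \<and> nb x = {y, z}" if "y \<in> nb x" for x y
  proof -
    have "card (nb x) = 2" using 2 that nb_in_verts by blast
    then obtain a b where "nb x = {a, b}" "a \<noteq> b" unfolding card_2_iff by blast
    with that show ?thesis by (cases "y = a") auto
  qed
  have uv: "v \<notin> nb u" "u \<notin> nb v" "nb u \<inter> nb v = {}" "u \<noteq> v"
    using nb_antipodes_disjoint[of u v] g V by auto
  obtain g5 where g5: "g5 \<noteq> g1" "nb u = {g1, g5}" using other[OF g(2)] by blast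
  have "g2 \<in> nb v" using g nb_commute by blast
  then obtain g4 where g4: "g4 \<noteq> g2" "nb v = {g2, g4}" using other by blast
  have VG: "pverts G = {u, v, g1, g5, g2, g4}"
    using verts_antipodes[of u v] g V g5 g4 by auto
  have distinct: "distinct [u, g1, g2, v, g4, g5]"
    using uv g5 g4 not_in_own_nb[of u] not_in_own_nb[of v] by auto
  have "u \<in> nb g1" using g nb_commute by blast
  then have n1: "nb g1 = {u, g2}" using other[of u g1] g distinct by auto
  have "g1 \<in> nb g2" using g nb_commute by blast
  then have n2: "nb g2 = {g1, v}" using other[of g1 g2] g distinct by auto
  have "v \<in> nb g4" using g4 nb_commute by blast
  then obtain z where z: "z \<noteq> v" "nb g4 = {v, z}" using other by blast
  then have "z \<in> nb g4" by simp
  then have "z \<in> pverts G" "g4 \<in> nb z" using nb_in_verts nb_commute by blast+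
  \<comment> \<open>\<open>u\<close>, \<open>g1\<close> and \<open>g2\<close> already have two
    neighbours other than \<open>g4\<close>, so only \<open>g5\<close> remains.\<close>
  then have "z = g5"
    using z(1) distinct n1 n2 g5(2) not_in_own_nb[of g4] unfolding VG by auto
  then have n4: "nb g4 = {v, g5}" using z by simp
  then have "g4 \<in> nb g5" "u \<in> nb g5" using nb_commute g5 by blast+
  then have n5: "nb g5 = {g4, u}" using other[of u g5] distinct by auto
  show ?thesis
    by (rule six_cycle_iso[OF pair_graph _ distinct])
      (use VG n1 n2 n4 n5 g5 g4 in auto)
qed

end

theorem theorem4p6:
  fixes G :: "'a pair_pre_digraph"
  assumes "pair_graph G"
    and "distance_regular G"
    and "graph_diameter G = 3"
  shows "grover_perfect_state_transfer G
    \<longleftrightarrow> digraph_iso (with_proj G) (with_proj (cycle_graph 6))"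
proof
  interpret pair_graph G by fact
  interpret distance_regular_graph_diameter_3 G by unfold_locales fact+
  assume "grover_perfect_state_transfer G"
  then obtain u v \<tau> \<gamma> where uv: "u \<in> pverts G" "v \<in> pverts G" "u \<noteq> v"
    and \<tau>: "\<tau> > 0" and \<gamma>: "cmod \<gamma> = 1"
    and pst: "\<And>a. a \<in> parcs G \<Longrightarrow>
      (step ^^ \<tau>) (grover_vertex_state G u) a = \<gamma> * grover_vertex_state G v a"
    unfolding grover_pst_iff by blast
  have sphere: "card {w \<in> pverts G. d u w = d u v} = 1"
    using transfer_sphere[OF uv \<gamma> pst] by simp
  then have 3: "d u v = 3" using singleton_sphere_dist uv by blast
  \<comment> \<open>Sphere sizes do not depend on the centre, so the unique antipode of
    \<open>u\<close> gives one for every vertex.\<close>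
  interpret antipodal_3 G
  proof
    show "card {w \<in> pverts G. d x w = 3} = 1" if "x \<in> pverts G" for x
      using card_sphere[OF that uv(1)] sphere 3 by simp
  qed
  have "card (nb u) = 2" using uv(1,2) 3 \<gamma> \<tau> pst by (rule transfer_valency)
  then show "digraph_iso (with_proj G) (with_proj (cycle_graph 6))"
    using card_nb_eq uv(1) by (intro valency_2_iso) metis
next
  assume "digraph_iso (with_proj G) (with_proj (cycle_graph 6))"
  with assms(1) show "grover_perfect_state_transfer G"
    by (rule pair_graph.six_cycle_transfer)
qed

end
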